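(* For all $\varepsilon\in(0,\pi/3)$, \[F_2(\varepsilon,3)=G_2(\varepsilon,3)=\frac{1}{\cos(\varepsilon/2)}-1.\]
   Context: A Steiner topology for $n$ terminals is a (graph-theoretic) tree $\mathcal{T}$ with $n$ special vertices $t_1,\dots,t_n$, called terminals, all of degree at most $3$, and all other vertices, called Steiner points, of degree exactly $3$. It is full if all terminals have degree $1$. Given a family $p_1,\dots,p_n$ of points in $\mathbb{R}^d$ (repetitions allowed), a Steiner tree with topology $\mathcal{T}$ on these points is a representation of $\mathcal{T}$ in $\mathbb{R}^d$ in which $t_i$ is represented by $p_i$, each Steiner point by an arbitrary point of $\mathbb{R}^d$, and each edge by a straight-line segment; points may coincide (so edges may have length $0$; such edges, and trees containing them, are called degenerate) and edges may cross. The length $L(T)$ is the sum of the Euclidean lengths of the edges. Angles are measured in $[0,\pi]$. For $\varepsilon\geq 0$, an $\varepsilon$-approximate Steiner tree is a tree with a Steiner topology such that at each Steiner point all three angles spanned by pairs of incident edges belong to $[2\pi/3-\varepsilon,2\pi/3+\varepsilon]$ (in particular these angles are defined, so edges at Steiner points have positive length). $\mathcal{A}_\varepsilon^d(n)$ denotes the set of all $\varepsilon$-approximate Steiner trees in $\mathbb{R}^d$ with full Steiner topology on $n$ terminals; thus $\mathcal{A}_0^d(n)$ is the set of all full locally minimum Steiner trees on $n$ terminals in $\mathbb{R}^d$ (non-degenerate, all angles at Steiner points equal to $2\pi/3$). For a tree $T$ in $\mathbb{R}^d$ with Steiner topology $\mathcal{T}$, $S(T)$ denotes the (unique) shortest tree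 in $\mathbb{R}^d$ on the terminals of $T$ with topology $\mathcal{T}$, where degenerate trees are allowed. Define \[F_d(\varepsilon,n)=\sup\left\{\frac{L(T)-L(S(T))}{L(S(T))}: T\in\mathcal{A}_\varepsilon^d(n)\right\},\] \[G_d(\varepsilon,n)=\sup\left\{\frac{L(T)-L(S(T))}{L(S(T))}: T\in\mathcal{A}_\varepsilon^d(n),\ S(T)\in\mathcal{A}_0^d(n)\right\}.\]
   Formalization: The claim as stated fails for ε in [2π/9, π/3) (three unit edges in a half-plane with angles θ, θ, 2θ, θ=2π/3−ε); it is proved literally for ε<2π/9, and on all of (0, π/3) for trees whose three angles at each Steiner point sum to 2π. *)

theory Defs
  imports "HOL-Analysis.Analysis"
begin

section \<open>Graph-theoretic trees and Steiner topologies\<close>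

text \<open>
  Edges are two-element vertex sets. Vertices are natural numbers: every finite graph is
  isomorphic to one on a finite set of naturals, so this does not restrict the topologies.
  The terminals are \<open>term 1, \<dots>, term n\<close>; values of \<open>term\<close> at other indices are irrelevant.
\<close>

record topology =
  verts :: "nat set"
  edges :: "nat set set"
  "term" :: "nat \<Rightarrow> nat"

definition connected_graph :: "nat set \<Rightarrow> nat set set \<Rightarrow> bool" where
  "connected_graph V E \<longleftrightarrow> V \<noteq> {} \<and> (\<forall>u\<in>V. \<forall>v\<in>V. (\<lambda>a b. {a, b} \<in> E)\<^sup>*\<^sup>* u v)"

definition is_cycle :: "nat set set \<Rightarrow> nat list \<Rightarrow> bool" where
  "is_cycle E c \<longleftrightarrow> 3 \<le> length c \<and> distinct c \<and>
     (\<forall>i<length c. {c ! i, c ! (Suc i mod length c)} \<in> E)"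

definition is_tree :: "nat set \<Rightarrow> nat set set \<Rightarrow> bool" where
  "is_tree V E \<longleftrightarrow> finite V \<and> (\<forall>e\<in>E. e \<subseteq> V \<and> card e = 2) \<and>
     connected_graph V E \<and> (\<nexists>c. is_cycle E c)"

definition neighbours :: "topology \<Rightarrow> nat \<Rightarrow> nat set" where
  "neighbours \<T> v = {u. {v, u} \<in> edges \<T>}"

definition degree :: "topology \<Rightarrow> nat \<Rightarrow> nat" where
  "degree \<T> v = card (neighbours \<T> v)"

definition terminals :: "nat \<Rightarrow> topology \<Rightarrow> nat set" where
  "terminals n \<T> = term \<T> ` {1..n}"

definition steiner_points :: "nat \<Rightarrow> topology \<Rightarrow> nat set" where
  "steiner_points n \<T> = verts \<T> - terminals n \<T>"

definition steiner_topology :: "nat \<Rightarrow> topology \<Rightarrow> bool" where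
  "steiner_topology n \<T> \<longleftrightarrow> is_tree (verts \<T>) (edges \<T>) \<and>
     inj_on (term \<T>) {1..n} \<and> terminals n \<T> \<subseteq> verts \<T> \<and>
     (\<forall>v\<in>terminals n \<T>. degree \<T> v \<le> 3) \<and>
     (\<forall>v\<in>steiner_points n \<T>. degree \<T> v = 3)"

definition full_steiner_topology :: "nat \<Rightarrow> topology \<Rightarrow> bool" where
  "full_steiner_topology n \<T> \<longleftrightarrow>
     steiner_topology n \<T> \<and> (\<forall>v\<in>terminals n \<T>. degree \<T> v = 1)"


section \<open>Steiner trees in Euclidean space\<close>

text \<open>
  A Steiner tree is a topology together with the positions of its vertices; the positions
  \<open>p\<^sub>i\<close> of the terminals are part of the representation. Positions may coincide.
\<close>

type_synonym 'd steiner_tree = "topology \<times> (nat \<Rightarrow> real ^ 'd)"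

definition len :: "'d::finite steiner_tree \<Rightarrow> real" where
  "len = (\<lambda>(\<T>, x). \<Sum>(u, v)\<in>{(u, v). u < v \<and> {u, v} \<in> edges \<T>}. dist (x u) (x v))"

definition angle :: "real ^ 'd::finite \<Rightarrow> real ^ 'd \<Rightarrow> real ^ 'd \<Rightarrow> real" where
  "angle p s q = arccos ((p - s) \<bullet> (q - s) / (norm (p - s) * norm (q - s)))"

definition approx_full_trees :: "real \<Rightarrow> nat \<Rightarrow> 'd::finite steiner_tree set" (\<open>\<A>\<close>) where
  "\<A> \<epsilon> n = {(\<T>, x). full_steiner_topology n \<T> \<and>
     (\<forall>s\<in>steiner_points n \<T>.
        (\<forall>u\<in>neighbours \<T> s. x u \<noteq> x s) \<and>
        (\<forall>u\<in>neighbours \<T> s. \<forall>v\<in>neighbours \<T> s. u \<noteq> v \<longrightarrow>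
           angle (x u) (x s) (x v) \<in> {2 * pi / 3 - \<epsilon> .. 2 * pi / 3 + \<epsilon>}))}"

text \<open>
  The shortest tree with the topology and the terminal positions of a given tree. Positions
  outside of the vertex set do not matter, so a minimiser is unique at most up to those;
  \<open>arg_min\<close> chooses one of the minimisers.
\<close>

definition shortest_tree :: "nat \<Rightarrow> 'd::finite steiner_tree \<Rightarrow> 'd steiner_tree" where
  "shortest_tree n = (\<lambda>(\<T>, x).
     (\<T>, ARG_MIN (\<lambda>y. len (\<T>, y)) y. \<forall>v\<in>terminals n \<T>. y v = x v))"

text \<open>
  Values in \<open>ereal\<close> make the suprema below genuine suprema also for unbounded sets, and make
  the error infinite if only the shortest tree has length \<open>0\<close>.
\<close>

definition rel_error :: "nat \<Rightarrow> 'd::finite steiner_tree \<Rightarrow> ereal" where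
  "rel_error n T =
     ereal (len T - len (shortest_tree n T)) / ereal (len (shortest_tree n T))"

definition F :: "'d::finite itself \<Rightarrow> real \<Rightarrow> nat \<Rightarrow> ereal" where
  "F _ \<epsilon> n = (SUP T \<in> (\<A> \<epsilon> n :: 'd steiner_tree set). rel_error n T)"

definition G :: "'d::finite itself \<Rightarrow> real \<Rightarrow> nat \<Rightarrow> ereal" where
  "G _ \<epsilon> n = (SUP T \<in> {T \<in> (\<A> \<epsilon> n :: 'd steiner_tree set). shortest_tree n T \<in> \<A> 0 n}.
     rel_error n T)"


section \<open>Angles around a Steiner point in the plane\<close>

text \<open>
  In the plane one expects the three angles at a Steiner point to be those of the three sectors
  around it, i.e. to add up to a full turn. For \<open>\<epsilon> < 2\<pi>/9\<close> membership in \<open>\<A> \<epsilon> n\<close> forces this: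
  otherwise one angle is the sum of the other two, and so
  \<open>2 (2\<pi>/3 - \<epsilon>) \<le> 2\<pi>/3 + \<epsilon>\<close>. For \<open>2\<pi>/9 \<le> \<epsilon> < \<pi>/3\<close> it does not: three unit edges in one
  half-plane with successive angles \<open>\<theta> = 2\<pi>/3 - \<epsilon>\<close> also span angles \<open>\<theta>, \<theta>, 2\<theta>\<close> within the
  permitted range. Moving the Steiner point to the middle terminal shows that this tree has
  relative error at least \<open>3 / (4 sin (\<theta>/2)) - 1\<close>, which exceeds \<open>1 / cos (\<epsilon>/2) - 1\<close>.
  Hence for such \<open>\<epsilon>\<close> the value of the suprema is \<open>1 / cos (\<epsilon>/2) - 1\<close> only with the sector
  reading of the angles, which the following definitions make explicit.
\<close>

definition sector_trees :: "real \<Rightarrow> nat \<Rightarrow> 2 steiner_tree set" where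
  "sector_trees \<epsilon> n = {(\<T>, x) \<in> \<A> \<epsilon> n.
     \<forall>s\<in>steiner_points n \<T>. \<forall>u v w. neighbours \<T> s = {u, v, w} \<longrightarrow>
       angle (x u) (x s) (x v) + angle (x v) (x s) (x w) + angle (x w) (x s) (x u) = 2 * pi}"

definition F_sector :: "real \<Rightarrow> nat \<Rightarrow> ereal" where
  "F_sector \<epsilon> n = (SUP T \<in> sector_trees \<epsilon> n. rel_error n T)"

definition G_sector :: "real \<Rightarrow> nat \<Rightarrow> ereal" where
  "G_sector \<epsilon> n = (SUP T \<in> {T \<in> sector_trees \<epsilon> n. shortest_tree n T \<in> \<A> 0 n}. rel_error n T)"

end

theory Submission
  imports Defs
begin

text \<open>
  A full topology on three terminals is a star, so a tree in question consists of a Steiner point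
  \<open>s\<close> and edges from \<open>s\<close> to three points \<open>p\<^sub>i\<close>, and \<open>S(T)\<close> is the shortest star on these points.

  Upper bound. Let \<open>u\<^sub>i\<close> be the directions of the edges at \<open>s\<close> and \<open>a\<^sub>i\<close> their lengths. When the
  angles at \<open>s\<close> add up to \<open>2\<pi>\<close>, there are unit vectors \<open>e\<^sub>i\<close> with sum \<open>0\<close> such that the angle
  between \<open>u\<^sub>i\<close> and \<open>e\<^sub>i\<close> is at most \<open>\<epsilon>/2\<close> (\<open>tripod_fit\<close>). For every point \<open>y\<close>,
  \<open>\<Sum> |p\<^sub>i - y| \<ge> \<Sum> e\<^sub>i \<bullet> (p\<^sub>i - y) = \<Sum> e\<^sub>i \<bullet> (p\<^sub>i - s) = \<Sum> a\<^sub>i (e\<^sub>i \<bullet> u\<^sub>i) \<ge> cos (\<epsilon>/2) L(T)\<close>,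
  where the first step is \<open>tripod_bound\<close>. Hence \<open>L(S(T)) \<ge> cos (\<epsilon>/2) L(T)\<close>.

  The bound is attained, by a tree whose shortest tree is non-degenerate (\<open>extremal_tree\<close>):
  edges of lengths \<open>1\<close>, \<open>1\<close>, \<open>2\<close> which deviate by \<open>\<epsilon>/2\<close>, \<open>\<epsilon>/2\<close>, \<open>-\<epsilon>/2\<close> from a regular tripod.
  So all the suprema over trees with sector angles are maxima with the same value. For
  \<open>\<epsilon> < 2\<pi>/9\<close> the angles at \<open>s\<close> always add up to \<open>2\<pi>\<close> (\<open>sector_trees_eq\<close>).
\<close>

section \<open>Directions and angles in the plane\<close>

text \<open>
  The unit vector of the plane with polar angle \<open>t\<close>.
\<close>

definition dir :: "real \<Rightarrow> real^2" where "dir t = vector [cos t, sin t]"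

lemma dir_nth [simp]: "dir t $ 1 = cos t" "dir t $ 2 = sin t"
  by (simp_all add: dir_def)

lemma dir_inner: "dir a \<bullet> dir b = cos (a - b)"
  by (simp add: inner_vec_def sum_2 cos_diff)

lemma norm_dir [simp]: "norm (dir t) = 1"
  by (simp add: norm_eq_sqrt_inner dir_inner)

lemma dir_neq_0 [simp]: "dir t \<noteq> 0"
  using norm_dir[of t] by (metis norm_zero zero_neq_one)

lemma polar:
  obtains t where "v = norm v *\<^sub>R dir t"
proof (cases "v = 0")
  case False
  define w where "w = v /\<^sub>R norm v"
  have "norm w = 1" using False by (simp add: w_def)
  then have "w \<bullet> w = 1" by (simp add: norm_eq_1)
  then have "(w $ 1)\<^sup>2 + (w $ 2)\<^sup>2 = 1"
    by (simp add: inner_vec_def sum_2 power2_eq_square)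
  then obtain t where "w $ 1 = cos t" "w $ 2 = sin t" using sincos_total_2pi by metis
  then have "w = dir t" by (simp add: vec_eq_iff forall_2)
  moreover have "v = norm v *\<^sub>R w" using False by (simp add: w_def)
  ultimately show ?thesis using that[of t] by simp
qed (use that in simp)

lemma angle_commute: "angle p s q = angle q s p"
  by (simp add: angle_def inner_commute mult.commute)

lemma angle_dir:
  assumes "p - s = a *\<^sub>R dir t" "q - s = b *\<^sub>R dir r" "0 < a" "0 < b"
  shows "angle p s q = arccos (cos (t - r))"
  using assms by (simp add: angle_def dir_inner)

lemma angle_dir_eq:
  assumes "p - s = a *\<^sub>R dir t" "q - s = b *\<^sub>R dir r" "0 < a" "0 < b"
    and "t - r = \<phi> \<or> t - r = - \<phi> \<or> t - r = 2 * pi - \<phi>" "0 \<le> \<phi>" "\<phi> \<le> pi"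
  shows "angle p s q = \<phi>"
proof -
  have "cos (t - r) = cos \<phi>" using assms(5) by (auto simp only: cos_minus cos_2pi_minus)
  then show ?thesis using angle_dir[OF assms(1-4)] assms(6,7) by (simp add: arccos_cos)
qed

lemma dir_at_angle:
  assumes "c = arccos (cos (t - r))"
  obtains s :: real where "s = 1 \<or> s = -1" "dir t = dir (r + s * c)"
proof -
  have c: "cos c = cos (t - r)" by (simp add: assms)
  then have "(sin c)\<^sup>2 = (sin (t - r))\<^sup>2" by (simp add: sin_squared_eq)
  then have "sin (t - r) = sin c \<or> sin (t - r) = - sin c" by (metis power2_eq_iff)
  then obtain s :: real where s: "s = 1 \<or> s = -1" "sin (t - r) = sin (s * c)"
    by (metis mult_1 mult_minus1 sin_minus)
  have cs: "cos (t - r) = cos (s * c)" using s(1) c by auto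
  have "dir t = dir (r + (t - r))" by simp
  also have "\<dots> = dir (r + s * c)"
    unfolding vec_eq_iff forall_2 dir_nth cos_add sin_add using s(2) cs by simp
  finally show ?thesis using that s(1) by blast
qed

lemma dir_relative:
  assumes "dir t = dir t'"
  shows "cos (t - r) = cos (t' - r)" "cos (r - t) = cos (r - t')"
  using assms dir_inner by metis+

text \<open>
  The angles between three rays from a common point of the plane. Measured from the first ray,
  the other two are at \<open>\<plusminus>\<alpha>\<close> and \<open>\<plusminus>\<gamma>\<close>. On the same side, one of the three angles is the sum
  of the other two. On opposite sides, this still holds if \<open>\<alpha> + \<gamma> \<le> \<pi>\<close>, and otherwise the angles
  add up to a full turn; the sign \<open>s\<close> then records the orientation of the configuration.
\<close>

lemma angles_cases:
  assumes "\<alpha> = arccos (cos (t1 - t2))" "\<beta> = arccos (cos (t2 - t3))" "\<gamma> = arccos (cos (t3 - t1))"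
  obtains (around) s :: real where "s = 1 \<or> s = -1" "\<alpha> + \<beta> + \<gamma> = 2 * pi"
      "dir t2 = dir (t1 + s * \<alpha>)" "dir t3 = dir (t1 - s * \<gamma>)"
  | (within) "\<alpha> = \<beta> + \<gamma> \<or> \<beta> = \<gamma> + \<alpha> \<or> \<gamma> = \<alpha> + \<beta>"
proof -
  have rng: "0 \<le> \<alpha>" "\<alpha> \<le> pi" "0 \<le> \<beta>" "\<beta> \<le> pi" "0 \<le> \<gamma>" "\<gamma> \<le> pi"
    unfolding assms by (auto intro!: arccos_lbound arccos_ubound)
  have "\<alpha> = arccos (cos (t2 - t1))"
    using cos_minus[of "t1 - t2"] by (simp add: assms(1))
  then obtain s :: real where s: "s = 1 \<or> s = -1" "dir t2 = dir (t1 + s * \<alpha>)"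
    by (rule dir_at_angle)
  obtain r :: real where r: "r = 1 \<or> r = -1" "dir t3 = dir (t1 + r * \<gamma>)"
    using assms(3) by (rule dir_at_angle)
  have "cos (t2 - t3) = cos ((t1 + s * \<alpha>) - (t1 + r * \<gamma>))"
    using dir_relative[OF s(2)] dir_relative[OF r(2)] by metis
  then have \<beta>: "cos \<beta> = cos (s * \<alpha> - r * \<gamma>)" by (simp add: assms(2))
  have flip: "cos (s * a) = cos a" for a using s(1) by (metis cos_minus mult_1 mult_minus1)
  show ?thesis
  proof (cases "r = s")
    case True
    have "s * \<alpha> - r * \<gamma> = s * (\<alpha> - \<gamma>)" using True by (simp add: algebra_simps)
    then have "cos \<beta> = cos \<bar>\<alpha> - \<gamma>\<bar>" using \<beta> flip by simp
    then have "\<beta> = \<bar>\<alpha> - \<gamma>\<bar>" using rng by (auto intro: cos_inj_pi)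
    then have "\<alpha> = \<beta> + \<gamma> \<or> \<beta> = \<gamma> + \<alpha> \<or> \<gamma> = \<alpha> + \<beta>" by linarith
    then show ?thesis by (rule within)
  next
    case False
    then have rs: "r = - s" using r(1) s(1) by auto
    have "s * \<alpha> - r * \<gamma> = s * (\<alpha> + \<gamma>)" using rs by (simp add: algebra_simps)
    then have b: "cos \<beta> = cos (\<alpha> + \<gamma>)" using \<beta> flip by simp
    show ?thesis
    proof (cases "\<alpha> + \<gamma> \<le> pi")
      case True
      then have "\<beta> = \<alpha> + \<gamma>" using b rng by (auto intro: cos_inj_pi)
      then have "\<alpha> = \<beta> + \<gamma> \<or> \<beta> = \<gamma> + \<alpha> \<or> \<gamma> = \<alpha> + \<beta>" by linarith
    then show ?thesis by (rule within)
    next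
      case False
      have "cos \<beta> = cos (2 * pi - (\<alpha> + \<gamma>))" using b by (simp add: cos_2pi_minus)
      then have "\<beta> = 2 * pi - (\<alpha> + \<gamma>)" using False rng by (auto intro: cos_inj_pi)
      then have "\<alpha> + \<beta> + \<gamma> = 2 * pi" by simp
      moreover have "dir t3 = dir (t1 - s * \<gamma>)"
        using r(2) rs by (metis diff_minus_eq_add minus_mult_left minus_minus)
      ultimately show ?thesis using around s by blast
    qed
  qed
qed

lemma dir_tripod:
  assumes "s = 1 \<or> s = -1"
  shows "dir \<eta> + dir (\<eta> + s * (2 * pi / 3)) + dir (\<eta> - s * (2 * pi / 3)) = 0"
proof -
  have "cos (s * (2 * pi / 3)) = - 1 / 2" "sin (s * (2 * pi / 3)) = s * (sqrt 3 / 2)"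
    using assms by (auto simp: cos_120 sin_120 simp del: times_divide_eq_right)
  then show ?thesis
    unfolding vec_eq_iff forall_2 vector_add_component dir_nth cos_add sin_add cos_diff sin_diff
    by (simp add: algebra_simps)
qed

text \<open>
  Three rays whose angles add up to \<open>2\<pi>\<close> and differ from \<open>2\<pi>/3\<close> by at most \<open>\<epsilon>\<close> can be matched
  with a regular tripod so that each ray is within \<open>\<epsilon>/2\<close> of its leg. Put the first leg on the
  first ray: the deviations are \<open>0\<close>, \<open>d\<close> and \<open>e\<close>, and any two of them differ by at most \<open>\<epsilon>\<close>,
  as each difference is the deviation of one of the angles from \<open>2\<pi>/3\<close>. Rotating the tripod by
  the midpoint of the range of the deviations halves the bound.
\<close>

lemma tripod_fit:
  assumes \<epsilon>: "0 < \<epsilon>" "\<epsilon> < pi / 3"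
    and def: "\<alpha> = arccos (cos (t1 - t2))" "\<beta> = arccos (cos (t2 - t3))" "\<gamma> = arccos (cos (t3 - t1))"
    and rng: "\<bar>\<alpha> - 2 * pi / 3\<bar> \<le> \<epsilon>" "\<bar>\<beta> - 2 * pi / 3\<bar> \<le> \<epsilon>" "\<bar>\<gamma> - 2 * pi / 3\<bar> \<le> \<epsilon>"
    and sum: "\<alpha> + \<beta> + \<gamma> = 2 * pi"
  obtains r1 r2 r3 where "dir r1 + dir r2 + dir r3 = 0"
    "cos (\<epsilon> / 2) \<le> dir t1 \<bullet> dir r1" "cos (\<epsilon> / 2) \<le> dir t2 \<bullet> dir r2" "cos (\<epsilon> / 2) \<le> dir t3 \<bullet> dir r3"
  using def
proof (cases rule: angles_cases)
  case within
  \<comment> \<open>One angle would be half of the full turn, which exceeds \<open>2\<pi>/3 + \<epsilon>\<close>.\<close>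
  moreover have "\<alpha> < pi" "\<beta> < pi" "\<gamma> < pi" using rng \<epsilon> by (simp_all add: abs_le_iff)
  ultimately show ?thesis using sum by linarith
next
  case (around s)
  define d e where "d = \<alpha> - 2 * pi / 3" and "e = 2 * pi / 3 - \<gamma>"
  define M m where "M = max 0 (max d e)" and "m = min 0 (min d e)"
  define \<phi> where "\<phi> = (M + m) / 2"
  have rng': "d \<le> \<epsilon>" "- d \<le> \<epsilon>" "e \<le> \<epsilon>" "- e \<le> \<epsilon>" "d - e \<le> \<epsilon>" "e - d \<le> \<epsilon>"
    using rng[unfolded abs_le_iff] sum unfolding d_def e_def by linarith+
  then have "M - m \<le> \<epsilon>" unfolding M_def m_def max_def min_def using \<epsilon>(1) by simp
  moreover have "0 \<le> M" "d \<le> M" "e \<le> M" "m \<le> 0" "m \<le> d" "m \<le> e"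
    unfolding M_def m_def by simp_all
  ultimately have dev: "\<bar>\<phi>\<bar> \<le> \<epsilon> / 2" "\<bar>d - \<phi>\<bar> \<le> \<epsilon> / 2" "\<bar>e - \<phi>\<bar> \<le> \<epsilon> / 2"
    unfolding \<phi>_def by (simp_all add: abs_le_iff field_simps)
  have small: "cos (\<epsilon> / 2) \<le> cos a" if "\<bar>a\<bar> \<le> \<epsilon> / 2" for a
    using cos_monotone_0_pi_le[of "\<bar>a\<bar>" "\<epsilon> / 2"] that \<epsilon> by simp
  define \<eta> where "\<eta> = t1 + s * \<phi>"
  have flip: "cos (s * a) = cos a" for a using around(1) by (metis cos_minus mult_1 mult_minus1)
  show ?thesis
  proof (rule that)
    show "dir \<eta> + dir (\<eta> + s * (2 * pi / 3)) + dir (\<eta> - s * (2 * pi / 3)) = 0"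
      using around(1) by (rule dir_tripod)
    have "dir t1 \<bullet> dir \<eta> = cos (s * \<phi>)" by (simp add: dir_inner \<eta>_def)
    then show "cos (\<epsilon> / 2) \<le> dir t1 \<bullet> dir \<eta>" using small dev flip by simp
    have "dir t2 \<bullet> dir (\<eta> + s * (2 * pi / 3)) = cos (s * (d - \<phi>))"
      unfolding around dir_inner \<eta>_def d_def by (simp add: algebra_simps)
    then show "cos (\<epsilon> / 2) \<le> dir t2 \<bullet> dir (\<eta> + s * (2 * pi / 3))" using small dev flip by simp
    have "dir t3 \<bullet> dir (\<eta> - s * (2 * pi / 3)) = cos (s * (e - \<phi>))"
      unfolding around dir_inner \<eta>_def e_def by (simp add: algebra_simps)
    then show "cos (\<epsilon> / 2) \<le> dir t3 \<bullet> dir (\<eta> - s * (2 * pi / 3))" using small dev flip by simp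
  qed
qed


section \<open>Shortest stars on three points\<close>

text \<open>
  The dual bound for the length of a star: as \<open>e1 + e2 + e3 = 0\<close>, the sum of the inner products
  does not depend on \<open>x\<close>, and for \<open>x = y\<close> it is at most the sum of the distances.
\<close>

lemma tripod_bound:
  fixes e1 e2 e3 :: "'a::real_inner"
  assumes "e1 + e2 + e3 = 0" "norm e1 = 1" "norm e2 = 1" "norm e3 = 1"
  shows "e1 \<bullet> (p1 - x) + e2 \<bullet> (p2 - x) + e3 \<bullet> (p3 - x) \<le> dist y p1 + dist y p2 + dist y p3"
proof -
  have *: "e \<bullet> (p - y) \<le> dist y p" if "norm e = 1" for e p :: 'a
    using norm_cauchy_schwarz[of e "p - y"] that by (simp add: dist_norm norm_minus_commute)
  have "e1 \<bullet> (p1 - x) + e2 \<bullet> (p2 - x) + e3 \<bullet> (p3 - x)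
      = e1 \<bullet> (p1 - y) + e2 \<bullet> (p2 - y) + e3 \<bullet> (p3 - y) + (e1 + e2 + e3) \<bullet> (y - x)"
    by (simp add: inner_diff_right inner_add_left)
  then show ?thesis using *[of e1 p1] *[of e2 p2] *[of e3 p3] assms by simp
qed

text \<open>
  If the three points lie on the legs of a regular tripod based at \<open>y\<close>, the dual bound is attained
  at \<open>y\<close>. It is attained nowhere else: equality in the Cauchy-Schwarz inequality makes \<open>z - y\<close> a
  multiple of each of the three legs.
\<close>

lemma tripod_unique:
  fixes e1 e2 e3 :: "'a::real_inner"
  assumes e: "e1 + e2 + e3 = 0" "norm e1 = 1" "norm e2 = 1" "norm e3 = 1"
    and b: "p1 - y = b1 *\<^sub>R e1" "p2 - y = b2 *\<^sub>R e2" "p3 - y = b3 *\<^sub>R e3" "0 \<le> b1" "0 \<le> b2" "0 \<le> b3"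
    and le: "dist z p1 + dist z p2 + dist z p3 \<le> dist y p1 + dist y p2 + dist y p3"
  shows "z = y"
proof -
  have ee: "e1 \<bullet> e1 = 1" "e2 \<bullet> e2 = 1" "e3 \<bullet> e3 = 1" using e by (simp_all add: norm_eq_1)
  have dy: "dist y p1 = b1" "dist y p2 = b2" "dist y p3 = b3"
    using b e by (simp_all add: dist_norm norm_minus_commute[of y])
  have cs: "e \<bullet> (p - z) \<le> dist z p" if "norm e = 1" for e p :: 'a
    using norm_cauchy_schwarz[of e "p - z"] that by (simp add: dist_norm norm_minus_commute)
  have "e1 \<bullet> (p1 - z) + e2 \<bullet> (p2 - z) + e3 \<bullet> (p3 - z)
      = e1 \<bullet> (p1 - y) + e2 \<bullet> (p2 - y) + e3 \<bullet> (p3 - y) + (e1 + e2 + e3) \<bullet> (y - z)"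
    by (simp add: inner_diff_right inner_add_left)
  also have "\<dots> = b1 + b2 + b3" unfolding b using e ee by simp
  finally have eq: "dist z p1 = e1 \<bullet> (p1 - z)" "dist z p2 = e2 \<bullet> (p2 - z)" "dist z p3 = e3 \<bullet> (p3 - z)"
    using le dy cs[OF e(2), of p1] cs[OF e(3), of p2] cs[OF e(4), of p3] by linarith+
  \<comment> \<open>All three inner products \<open>e\<^sub>i \<bullet> (z - y)\<close> have the absolute value \<open>norm (z - y)\<close>, while
    their sum is \<open>0\<close>.\<close>
  have "(e \<bullet> (z - y))\<^sup>2 = (z - y) \<bullet> (z - y)"
    if "norm e = 1" "p - y = b *\<^sub>R e" "dist z p = e \<bullet> (p - z)" for e p b
  proof -
    have "p - z = dist z p *\<^sub>R e"
      using norm_cauchy_schwarz_eq[of e "p - z"] that(1,3) by (simp add: dist_norm norm_minus_commute)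
    moreover have "z - y = (p - y) - (p - z)" by simp
    ultimately have "z - y = (b - dist z p) *\<^sub>R e" using that(2) by (metis scaleR_left_diff_distrib)
    then show ?thesis using that by (simp add: norm_eq_1 power2_eq_square)
  qed
  note sq = this[OF e(2) b(1) eq(1)] this[OF e(3) b(2) eq(2)] this[OF e(4) b(3) eq(3)]
  have "e1 \<bullet> (z - y) + e2 \<bullet> (z - y) + e3 \<bullet> (z - y) = 0"
    using e by (simp flip: inner_add_left)
  moreover have "(e1 \<bullet> (z - y))\<^sup>2 = (e2 \<bullet> (z - y))\<^sup>2" "(e1 \<bullet> (z - y))\<^sup>2 = (e3 \<bullet> (z - y))\<^sup>2"
    using sq by simp_all
  ultimately have "e1 \<bullet> (z - y) = 0" by (auto simp: power2_eq_iff)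
  then show ?thesis using sq(1) by simp
qed

text \<open>
  Outside of the ball around \<open>p1\<close> whose radius is the sum of the three distances from \<open>p1\<close>, the
  sum of the distances exceeds its value at \<open>p1\<close>, so its minimum over the ball is a global one.
\<close>

lemma fermat_point_exists:
  fixes p1 p2 p3 :: "'a::euclidean_space"
  obtains y where "\<And>z. dist y p1 + dist y p2 + dist y p3 \<le> dist z p1 + dist z p2 + dist z p3"
proof -
  define f where "f z = dist z p1 + dist z p2 + dist z p3" for z
  have "continuous_on (cball p1 (f p1)) f" unfolding f_def by (intro continuous_intros)
  moreover have p1: "p1 \<in> cball p1 (f p1)" by (simp add: f_def)
  ultimately obtain y where y: "\<And>z. z \<in> cball p1 (f p1) \<Longrightarrow> f y \<le> f z"
    using continuous_attains_inf[of "cball p1 (f p1)" f] by (metis compact_cball empty_iff)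
  have "f y \<le> f z" for z
  proof (cases "z \<in> cball p1 (f p1)")
    case False
    then have "f p1 \<le> dist z p1" by (simp add: dist_commute)
    also have "\<dots> \<le> f z" by (simp add: f_def)
    finally show ?thesis using y[OF p1] by simp
  qed (rule y)
  then show ?thesis using that unfolding f_def by blast
qed


section \<open>Full topologies on three terminals\<close>

text \<open>
  The first vertex of a path of Steiner points that cannot be extended has no other Steiner point
  among its neighbours than its successor: a further one would lie on the path and close a cycle.
\<close>

lemma steiner_points_path:
  assumes steiner: "full_steiner_topology n T"
    and c: "set c \<subseteq> steiner_points n T" "distinct c" "c \<noteq> []"
      "\<And>i. Suc i < length c \<Longrightarrow> {c ! i, c ! Suc i} \<in> edges T"
    and maximal: "\<And>w. w \<in> steiner_points n T \<Longrightarrow> {w, c ! 0} \<in> edges T \<Longrightarrow> w \<in> set c"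
  shows "neighbours T (c ! 0) - (if length c = 1 then {} else {c ! 1}) \<subseteq> terminals n T"
proof
  fix w assume w: "w \<in> neighbours T (c ! 0) - (if length c = 1 then {} else {c ! 1})"
  have tree: "is_tree (verts T) (edges T)"
    using steiner by (simp add: full_steiner_topology_def steiner_topology_def)
  have E: "{c ! 0, w} \<in> edges T" using w by (simp add: neighbours_def)
  then have V: "w \<in> verts T" "w \<noteq> c ! 0" using tree by (auto simp: is_tree_def)
  show "w \<in> terminals n T"
  proof (rule ccontr)
    assume "w \<notin> terminals n T"
    then have "w \<in> set c" using maximal E V by (simp add: steiner_points_def insert_commute)
    then obtain j where j: "j < length c" "w = c ! j" by (auto simp: in_set_conv_nth)
    have "j \<noteq> 0" using V j by metis
    moreover have "j \<noteq> 1" using w j by (auto split: if_splits)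
    ultimately have "is_cycle (edges T) (take (Suc j) c)"
      unfolding is_cycle_def
    proof (intro conjI allI impI)
      fix i assume "i < length (take (Suc j) c)"
      then consider "i < j" | "i = j" using j by fastforce
      then show "{take (Suc j) c ! i, take (Suc j) c ! (Suc i mod length (take (Suc j) c))} \<in> edges T"
        using j c(4)[of i] E by cases (simp_all add: min_absorb2 insert_commute)
    qed (use j c in auto)
    then show False using tree by (auto simp: is_tree_def)
  qed
qed

lemma connected_closed:
  assumes "connected_graph V E" "a \<in> V" "a \<in> A"
    and "\<And>u v. u \<in> A \<Longrightarrow> {u, v} \<in> E \<Longrightarrow> v \<in> A"
  shows "V \<subseteq> A"
proof
  fix v assume "v \<in> V"
  then have "(\<lambda>a b. {a, b} \<in> E)\<^sup>*\<^sup>* a v" using assms by (auto simp: connected_graph_def)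
  then show "v \<in> A" by induction (use assms in auto)
qed

text \<open>
  If a longest path of Steiner points had two different ends, each of them would be adjacent to at
  least two terminals. As a terminal has only one neighbour, there would be four terminals. So the
  path is a single Steiner point, adjacent to the three terminals, and by connectedness there are
  no further vertices.
\<close>

lemma full_topology_3_star:
  assumes "full_steiner_topology 3 T"
  obtains s where "steiner_points 3 T = {s}" "s \<notin> terminals 3 T" "neighbours T s = terminals 3 T"
    "edges T = (\<lambda>t. {s, t}) ` terminals 3 T"
proof -
  let ?S = "steiner_points 3 T" and ?K = "terminals 3 T"
  have tree: "is_tree (verts T) (edges T)" and K: "?K \<subseteq> verts T"
    and deg1: "\<And>t. t \<in> ?K \<Longrightarrow> card (neighbours T t) = 1"
    and deg3: "\<And>s. s \<in> ?S \<Longrightarrow> card (neighbours T s) = 3"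
    and inj: "inj_on (term T) {1..3}"
    using assms by (auto simp: full_steiner_topology_def steiner_topology_def degree_def)
  have cardK: "card ?K = 3" using inj by (simp add: terminals_def card_image)
  then have finK: "finite ?K" using card.infinite by fastforce
  have fin: "finite (verts T)" and conn: "connected_graph (verts T) (edges T)"
    using tree by (auto simp: is_tree_def)
  have edgeV: "u \<in> verts T \<and> v \<in> verts T \<and> u \<noteq> v" if "{u, v} \<in> edges T" for u v
    using tree that by (auto simp: is_tree_def)
  have sym: "u \<in> neighbours T v \<longleftrightarrow> v \<in> neighbours T u" for u v
    by (simp add: neighbours_def insert_commute)
  have only: "u = v" if "t \<in> ?K" "t \<in> neighbours T u" "t \<in> neighbours T v" for t u v
    using deg1[OF that(1)] that(2,3) sym by (metis card_1_singletonE singletonD)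
  have "?S \<noteq> {}"
  proof
    \<comment> \<open>Without Steiner points, a terminal and its only neighbour form a component.\<close>
    assume S: "?S = {}"
    obtain t where t: "t \<in> ?K" using cardK by fastforce
    obtain a where a: "neighbours T t = {a}" using deg1[OF t] card_1_singletonE by metis
    then have "a \<in> ?K" using edgeV[of t a] S by (auto simp: neighbours_def steiner_points_def)
    then have "neighbours T a = {t}" using deg1 a sym by (metis card_1_singletonE insertI1 singletonD)
    then have "verts T \<subseteq> {t, a}"
      using a t K by (intro connected_closed[OF conn, of t]) (auto simp: neighbours_def)
    then have "card ?K \<le> card {t, a}" using K by (meson card_mono finite.intros order_trans)
    then show False using cardK card_insert_le_m1[of 2 "{a}" t] by simp
  qed
  define P where "P c \<longleftrightarrow> set c \<subseteq> ?S \<and> distinct c \<and> c \<noteq> [] \<and>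
    (\<forall>i. Suc i < length c \<longrightarrow> {c ! i, c ! Suc i} \<in> edges T)" for c
  obtain s0 where "s0 \<in> ?S" using \<open>?S \<noteq> {}\<close> by blast
  then have P1: "P [s0]" by (simp add: P_def)
  have "length c \<le> card (verts T)" if "P c" for c
    using that fin by (metis P_def card_mono distinct_card Diff_subset steiner_points_def order_trans)
  then obtain c where c: "P c" and longest: "\<And>d. P d \<Longrightarrow> length d \<le> length c"
    using ex_has_greatest_nat[of P "[s0]" length "Suc (card (verts T))"] P1 le_imp_less_Suc by metis
  have ends: "neighbours T (d ! 0) - (if length d = 1 then {} else {d ! 1}) \<subseteq> ?K"
    if d: "P d" "length d = length c" for d
  proof (rule steiner_points_path[OF assms])
    fix w assume w: "w \<in> ?S" "{w, d ! 0} \<in> edges T"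
    show "w \<in> set d"
    proof (rule ccontr)
      assume "w \<notin> set d"
      then have "P (w # d)" using d(1) w by (auto simp: P_def nth_Cons split: nat.splits)
      then show False using longest[of "w # d"] d(2) by simp
    qed
  qed (use d(1) in \<open>auto simp: P_def\<close>)
  have len1: "length c = 1"
  proof (rule ccontr)
    assume "length c \<noteq> 1"
    then have l: "2 \<le> length c" using c by (cases c) (auto simp: P_def Suc_le_eq)
    have rev: "P (rev c)"
      unfolding P_def
    proof (intro conjI allI impI)
      fix i assume i: "Suc i < length (rev c)"
      then have "Suc (length c - Suc (Suc i)) = length c - Suc i" by simp
      moreover have "{c ! (length c - Suc (Suc i)), c ! Suc (length c - Suc (Suc i))} \<in> edges T"
        using c i by (simp add: P_def)
      ultimately show "{rev c ! i, rev c ! Suc i} \<in> edges T"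
        using i by (simp add: rev_nth insert_commute)
    qed (use c in \<open>auto simp: P_def\<close>)
    have two: "2 \<le> card (neighbours T (d ! 0) - {d ! 1}) \<and> neighbours T (d ! 0) - {d ! 1} \<subseteq> ?K"
      if d: "P d" "length d = length c" for d
    proof
      have "d ! 0 \<in> ?S" using d(1) by (cases d) (auto simp: P_def)
      then have "card (neighbours T (d ! 0)) = 3" by (rule deg3)
      then show "2 \<le> card (neighbours T (d ! 0) - {d ! 1})"
        using diff_card_le_card_Diff[of "{d ! 1}" "neighbours T (d ! 0)"] by simp
      show "neighbours T (d ! 0) - {d ! 1} \<subseteq> ?K" using ends[OF d] l d(2) by auto
    qed
    let ?A = "neighbours T (c ! 0) - {c ! 1}" and ?B = "neighbours T (rev c ! 0) - {rev c ! 1}"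
    have "c ! 0 \<noteq> rev c ! 0"
      using l c by (simp add: rev_nth P_def nth_eq_iff_index_eq)
    then have disj: "?A \<inter> ?B = {}" using only two[OF c refl] by blast
    have AB: "finite ?A" "finite ?B" 
      using finite_subset[OF conjunct2[OF two[OF c refl]] finK]
        finite_subset[OF conjunct2[OF two[OF rev length_rev]] finK] by blast+
    have "card (?A \<union> ?B) = card ?A + card ?B" by (rule card_Un_disjoint[OF AB disj])
    moreover have "card (?A \<union> ?B) \<le> card ?K"
      using two[OF c refl] two[OF rev length_rev] finK by (intro card_mono) auto
    ultimately show False using two[OF c refl] two[OF rev length_rev] cardK by simp
  qed
  define s where "s = c ! 0"
  have s: "s \<in> ?S" using c by (cases c) (auto simp: P_def s_def)
  have "neighbours T s \<subseteq> ?K" using ends[OF c refl] len1 by (simp add: s_def)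
  then have N: "neighbours T s = ?K"
    using card_subset_eq[OF finK] deg3[OF s] cardK by simp
  have Nt: "neighbours T t = {s}" if "t \<in> ?K" for t
    using that N deg1[OF that] sym by (metis card_1_singletonE singletonD)
  have sK: "s \<notin> ?K" using s by (simp add: steiner_points_def)
  have V: "verts T \<subseteq> insert s ?K"
  proof (rule connected_closed[OF conn])
    show "s \<in> verts T" using s by (simp add: steiner_points_def)
    fix u v assume "u \<in> insert s ?K" "{u, v} \<in> edges T"
    then show "v \<in> insert s ?K" using N Nt by (auto simp: neighbours_def)
  qed simp
  have "?S = {s}" using V s by (auto simp: steiner_points_def)
  moreover have "edges T = (\<lambda>t. {s, t}) ` ?K"
  proof
    show "(\<lambda>t. {s, t}) ` ?K \<subseteq> edges T" using N by (auto simp: neighbours_def)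
    show "edges T \<subseteq> (\<lambda>t. {s, t}) ` ?K"
    proof
      fix e assume e: "e \<in> edges T"
      then obtain u v where uv: "e = {u, v}"
        using tree by (metis is_tree_def card_2_iff)
      have "u \<in> insert s ?K" using edgeV[of u v] e uv V by auto
      then show "e \<in> (\<lambda>t. {s, t}) ` ?K"
      proof
        assume "u = s" then show ?thesis using e uv N by (auto simp: neighbours_def)
      next
        assume u: "u \<in> ?K"
        then have "v = s" using Nt e uv by (auto simp: neighbours_def)
        then show ?thesis using u uv by (auto simp: insert_commute)
      qed
    qed
  qed
  ultimately show ?thesis using that sK N by blast
qed

lemma len_star:
  assumes "edges T = (\<lambda>t. {s, t}) ` K" "s \<notin> K" 
  shows "len (T, x) = (\<Sum>t\<in>K. dist (x s) (x t))"
proof -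
  have "(\<Sum>(u, v)\<in>{(u, v). u < v \<and> {u, v} \<in> edges T}. dist (x u) (x v)) = (\<Sum>t\<in>K. dist (x s) (x t))"
    by (rule sum.reindex_bij_witness[where i = "\<lambda>t. (min s t, max s t)"
          and j = "\<lambda>(u, v). if u = s then v else u"])
      (use assms in \<open>auto simp: le_less doubleton_eq_iff min_def max_def dist_commute insert_commute\<close>)
  then show ?thesis by (simp add: len_def)
qed

text \<open>
  There are no cycles: the first two edges of a cycle both contain the centre, so the centre would
  be the second vertex, and the third edge would miss it.
\<close>

lemma is_tree_star:
  assumes "finite K" "s \<notin> K"
  shows "is_tree (insert s K) ((\<lambda>t. {s, t}) ` K)"
  unfolding is_tree_def
proof (intro conjI)
  let ?E = "(\<lambda>t. {s, t}) ` K"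
  have conn: "(\<lambda>a b. {a, b} \<in> ?E)\<^sup>*\<^sup>* s v" "(\<lambda>a b. {a, b} \<in> ?E)\<^sup>*\<^sup>* v s" if "v \<in> insert s K" for v
    using that by (cases "v = s"; auto simp: insert_commute)+
  show "connected_graph (insert s K) ?E"
    unfolding connected_graph_def using conn rtranclp_trans[of _ _ s] by blast
  show "\<nexists>c. is_cycle ?E c"
  proof
    assume "\<exists>c. is_cycle ?E c"
    then obtain c where c: "3 \<le> length c" "distinct c"
      and edge: "\<And>i. i < length c \<Longrightarrow> {c ! i, c ! (Suc i mod length c)} \<in> ?E"
      by (auto simp: is_cycle_def)
    have s: "c ! i = s \<or> c ! (Suc i mod length c) = s" if "i < length c" for i
      using edge[OF that] by (auto simp: doubleton_eq_iff)
    have neq: "c ! i \<noteq> c ! j" if "i < length c" "j < length c" "i \<noteq> j" for i j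
      using that c by (simp add: nth_eq_iff_index_eq)
    have "Suc 0 mod length c = 1" "Suc 1 mod length c = 2" using c by simp_all
    then have 0: "c ! 0 = s \<or> c ! 1 = s" "c ! 1 = s \<or> c ! 2 = s"
      using s[of 0] s[of 1] c(1) by (simp_all only: One_nat_def[symmetric])
    then have 1: "c ! 1 = s" using neq[of 0 2] c by fastforce
    define j where "j = 3 mod length c"
    have "j < length c" "j \<noteq> 1"
      using c by (auto simp: j_def le_less)
    moreover have "c ! 2 = s \<or> c ! j = s" using s[of 2] c by (simp add: j_def numeral_eq_Suc)
    ultimately show False using 1 neq[of 1 2] neq[of 1 j] c by auto
  qed
qed (use assms in \<open>auto simp: card_2_iff\<close>)

lemma full_topology_3:
  assumes "full_steiner_topology 3 T"
  obtains s a b c where "steiner_points 3 T = {s}" "terminals 3 T = {a, b, c}" "distinct [s, a, b, c]"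
    "neighbours T s = {a, b, c}" "edges T = (\<lambda>t. {s, t}) ` {a, b, c}"
proof -
  obtain s where s: "steiner_points 3 T = {s}" "s \<notin> terminals 3 T" "neighbours T s = terminals 3 T"
    "edges T = (\<lambda>t. {s, t}) ` terminals 3 T"
    using assms by (rule full_topology_3_star)
  have "card (terminals 3 T) = 3"
    using assms by (simp add: full_steiner_topology_def steiner_topology_def terminals_def card_image)
  then obtain a b c where abc: "terminals 3 T = {a, b, c}" "distinct [a, b, c]"
    by (auto simp: card_3_iff)
  show ?thesis
  proof (rule that)
    show "distinct [s, a, b, c]" using s(2) abc by simp
  qed (use s abc in simp_all)
qed

lemma len_star3:
  assumes "edges T = (\<lambda>t. {s, t}) ` {a, b, c}" "distinct [s, a, b, c]"
  shows "len (T, x) = dist (x s) (x a) + dist (x s) (x b) + dist (x s) (x c)"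
proof -
  have "s \<notin> {a, b, c}" using assms(2) by auto
  then show ?thesis using len_star[OF assms(1)] assms(2) by (simp add: add.assoc)
qed

text \<open>
  The chosen minimiser is a genuine one, because a minimum exists.
\<close>

lemma shortest_tree_3:
  fixes x :: "nat \<Rightarrow> real ^ 'd::finite"
  assumes T: "terminals 3 T = {a, b, c}" "distinct [s, a, b, c]" "edges T = (\<lambda>t. {s, t}) ` {a, b, c}"
  obtains y where "shortest_tree 3 (T, x) = (T, y)" "y a = x a" "y b = x b" "y c = x c"
    "\<And>z. dist (y s) (x a) + dist (y s) (x b) + dist (y s) (x c) \<le> dist z (x a) + dist z (x b) + dist z (x c)"
proof -
  let ?P = "\<lambda>y. \<forall>v\<in>terminals 3 T. y v = x v" and ?f = "\<lambda>y. len (T, y)"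
  note len = len_star3[OF T(3,2)]
  have s: "s \<noteq> a" "s \<noteq> b" "s \<noteq> c" using T by auto
  obtain p where p: "\<And>z. dist p (x a) + dist p (x b) + dist p (x c) \<le> dist z (x a) + dist z (x b) + dist z (x c)"
    using fermat_point_exists by blast
  have "is_arg_min ?f ?P (x(s := p))"
    using p s by (auto simp: is_arg_min_linorder T len)
  then have y: "is_arg_min ?f ?P (arg_min ?f ?P)" (is "is_arg_min _ _ ?y")
    unfolding arg_min_def by (rule someI[of "is_arg_min ?f ?P"])
  have eq: "?y a = x a" "?y b = x b" "?y c = x c" using y by (auto simp: is_arg_min_def T)
  have "dist (?y s) (x a) + dist (?y s) (x b) + dist (?y s) (x c) \<le> dist z (x a) + dist z (x b) + dist z (x c)" for z
  proof -
    have "?f ?y \<le> ?f (x(s := z))" using y s unfolding is_arg_min_linorder T by simp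
    then show ?thesis using eq s by (simp add: len)
  qed
  then show ?thesis using that[of ?y] eq by (simp add: shortest_tree_def)
qed


section \<open>The upper bound\<close>

lemma rel_error_sector_le:
  assumes \<epsilon>: "0 < \<epsilon>" "\<epsilon> < pi / 3" and T: "T \<in> sector_trees \<epsilon> 3"
  shows "rel_error 3 T \<le> ereal (1 / cos (\<epsilon> / 2) - 1)"
proof -
  obtain \<T> x where Tx: "T = (\<T>, x)" by fastforce
  have full: "full_steiner_topology 3 \<T>" using T by (simp add: Tx sector_trees_def approx_full_trees_def)
  then obtain s a b c where star: "steiner_points 3 \<T> = {s}" "terminals 3 \<T> = {a, b, c}"
    "distinct [s, a, b, c]" "neighbours \<T> s = {a, b, c}" "edges \<T> = (\<lambda>t. {s, t}) ` {a, b, c}"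
    by (rule full_topology_3)
  note len = len_star3[OF star(5,3)]
  obtain y where S: "shortest_tree 3 T = (\<T>, y)" "y a = x a" "y b = x b" "y c = x c"
    using shortest_tree_3[OF star(2,3,5), of x] unfolding Tx by metis
  define A B C where "A = norm (x a - x s)" and "B = norm (x b - x s)" and "C = norm (x c - x s)"
  obtain ta tb tc where pol: "x a - x s = A *\<^sub>R dir ta" "x b - x s = B *\<^sub>R dir tb" "x c - x s = C *\<^sub>R dir tc"
    unfolding A_def B_def C_def using polar by metis
  have pos: "0 < A" "0 < B" "0 < C"
    using T star by (auto simp: Tx sector_trees_def approx_full_trees_def A_def B_def C_def)
  have ang: "angle (x a) (x s) (x b) = arccos (cos (ta - tb))"
    "angle (x b) (x s) (x c) = arccos (cos (tb - tc))"
    "angle (x c) (x s) (x a) = arccos (cos (tc - ta))"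
    using pol pos by (auto intro!: angle_dir)
  have rng: "\<bar>angle (x a) (x s) (x b) - 2 * pi / 3\<bar> \<le> \<epsilon>"
    "\<bar>angle (x b) (x s) (x c) - 2 * pi / 3\<bar> \<le> \<epsilon>"
    "\<bar>angle (x c) (x s) (x a) - 2 * pi / 3\<bar> \<le> \<epsilon>"
    using T star by (auto simp: Tx sector_trees_def approx_full_trees_def abs_le_iff)
  have "angle (x a) (x s) (x b) + angle (x b) (x s) (x c) + angle (x c) (x s) (x a) = 2 * pi"
    using T star by (auto simp: Tx sector_trees_def)
  with \<epsilon> ang rng obtain ra rb rc where r: "dir ra + dir rb + dir rc = 0"
    "cos (\<epsilon> / 2) \<le> dir ta \<bullet> dir ra" "cos (\<epsilon> / 2) \<le> dir tb \<bullet> dir rb" "cos (\<epsilon> / 2) \<le> dir tc \<bullet> dir rc"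
    by (rule tripod_fit)
  have lenT: "len T = A + B + C"
    by (simp add: Tx len A_def B_def C_def dist_norm norm_minus_commute)
  have "cos (\<epsilon> / 2) * len T = A * cos (\<epsilon> / 2) + B * cos (\<epsilon> / 2) + C * cos (\<epsilon> / 2)"
    by (simp add: lenT algebra_simps)
  also have "\<dots> \<le> A * (dir ta \<bullet> dir ra) + B * (dir tb \<bullet> dir rb) + C * (dir tc \<bullet> dir rc)"
    using r pos by (intro add_mono mult_left_mono) auto
  also have "\<dots> = dir ra \<bullet> (x a - x s) + dir rb \<bullet> (x b - x s) + dir rc \<bullet> (x c - x s)"
    by (simp add: pol inner_commute)
  also have "\<dots> \<le> dist (y s) (x a) + dist (y s) (x b) + dist (y s) (x c)"
    using r(1) by (rule tripod_bound) auto
  also have "\<dots> = len (shortest_tree 3 T)" by (simp add: S len)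
  finally have le: "cos (\<epsilon> / 2) * len T \<le> len (shortest_tree 3 T)" .
  have cos: "0 < cos (\<epsilon> / 2)" using \<epsilon> by (intro cos_gt_zero_pi) auto
  have "0 < len T" using pos lenT by simp
  then have "0 < cos (\<epsilon> / 2) * len T" using cos by simp
  then have pS: "0 < len (shortest_tree 3 T)" using le by linarith
  then have "(len T - len (shortest_tree 3 T)) / len (shortest_tree 3 T) \<le> 1 / cos (\<epsilon> / 2) - 1"
    using le cos by (simp add: field_simps)
  then show ?thesis using pS by (simp add: rel_error_def)
qed

text \<open>
  For \<open>\<epsilon> < 2\<pi>/9\<close> no angle is the sum of the other two, since \<open>2 (2\<pi>/3 - \<epsilon>) > 2\<pi>/3 + \<epsilon>\<close>.
\<close>

lemma sector_trees_eq:
  assumes "0 < \<epsilon>" "\<epsilon> < 2 * pi / 9"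
  shows "sector_trees \<epsilon> 3 = \<A> \<epsilon> 3"
proof
  show "sector_trees \<epsilon> 3 \<subseteq> \<A> \<epsilon> 3" by (auto simp: sector_trees_def)
  show "\<A> \<epsilon> 3 \<subseteq> sector_trees \<epsilon> 3"
  proof
    fix T :: "2 steiner_tree" assume T: "T \<in> \<A> \<epsilon> 3"
    obtain \<T> x where Tx: "T = (\<T>, x)" by fastforce
    have "angle (x u) (x s) (x v) + angle (x v) (x s) (x w) + angle (x w) (x s) (x u) = 2 * pi"
      if s: "s \<in> steiner_points 3 \<T>" and N: "neighbours \<T> s = {u, v, w}" for s u v w
    proof -
      have "card {u, v, w} = 3"
        using T s N[symmetric]
        by (simp add: Tx approx_full_trees_def full_steiner_topology_def steiner_topology_def degree_def)
      then have "u \<noteq> v" "v \<noteq> w" "w \<noteq> u" by (auto simp: card_insert_if split: if_splits)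
      then have rng: "angle (x u) (x s) (x v) \<in> {2 * pi / 3 - \<epsilon> .. 2 * pi / 3 + \<epsilon>}"
        "angle (x v) (x s) (x w) \<in> {2 * pi / 3 - \<epsilon> .. 2 * pi / 3 + \<epsilon>}"
        "angle (x w) (x s) (x u) \<in> {2 * pi / 3 - \<epsilon> .. 2 * pi / 3 + \<epsilon>}"
        and ne: "x u - x s \<noteq> 0" "x v - x s \<noteq> 0" "x w - x s \<noteq> 0"
        using T s N by (auto simp: Tx approx_full_trees_def)
      obtain tu tv tw where "x u - x s = norm (x u - x s) *\<^sub>R dir tu"
        "x v - x s = norm (x v - x s) *\<^sub>R dir tv" "x w - x s = norm (x w - x s) *\<^sub>R dir tw"
        using polar by metis
      then have "angle (x u) (x s) (x v) = arccos (cos (tu - tv))"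
        "angle (x v) (x s) (x w) = arccos (cos (tv - tw))"
        "angle (x w) (x s) (x u) = arccos (cos (tw - tu))"
        using ne by (auto intro: angle_dir simp only: zero_less_norm_iff)
      then show ?thesis
        by (cases rule: angles_cases) (use rng assms in auto)
    qed
    then show "T \<in> sector_trees \<epsilon> 3" using T unfolding Tx sector_trees_def by simp
  qed
qed


section \<open>A tree attaining the bound\<close>

text \<open>
  The full topology on three terminals, up to isomorphism: the Steiner point \<open>0\<close> is
  joined to the terminals \<open>1\<close>, \<open>2\<close> and \<open>3\<close>.
\<close>

definition star3 :: topology where
  "star3 = \<lparr>verts = {0, 1, 2, 3}, edges = (\<lambda>t. {0, t}) ` {1, 2, 3}, term = id\<rparr>"

lemma star3_full:
  "terminals 3 star3 = {1, 2, 3}" "steiner_points 3 star3 = {0}" "neighbours star3 0 = {1, 2, 3}"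
  "full_steiner_topology 3 star3"
proof -
  have "{1..3::nat} = {1, 2, 3}" by auto
  then show t: "terminals 3 star3 = {1, 2, 3}" by (simp add: terminals_def star3_def)
  then show s: "steiner_points 3 star3 = {0}" by (auto simp: steiner_points_def star3_def)
  show n: "neighbours star3 0 = {1, 2, 3}" by (auto simp: neighbours_def star3_def doubleton_eq_iff)
  have n': "neighbours star3 v = {0}" if "v \<in> {1, 2, 3}" for v
    using that by (auto simp: neighbours_def star3_def doubleton_eq_iff)
  have "is_tree (verts star3) (edges star3)"
    using is_tree_star[of "{1, 2, 3}" 0] by (simp add: star3_def)
  then show "full_steiner_topology 3 star3"
    unfolding full_steiner_topology_def steiner_topology_def
    using t s n n' by (auto simp: degree_def star3_def)
qed

text \<open>
  Equality in the upper bound requires that each edge deviates by exactly \<open>\<epsilon>/2\<close> from its leg of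
  the tripod, and that the edge vectors minus the legs, scaled to the right lengths, are all
  the same vector. For a tripod with the legs \<open>2\<pi>/3\<close>, \<open>-2\<pi>/3\<close> and \<open>0\<close>, take the deviations
  \<open>\<epsilon>/2\<close>, \<open>\<epsilon>/2\<close> and \<open>-\<epsilon>/2\<close>; the components of the edges orthogonal to their legs then have to
  cancel, so the third edge is as long as the other two together. The lengths are \<open>1\<close>, \<open>1\<close>, \<open>2\<close>,
  and the shortest tree has its Steiner point at \<open>q = (0, -2 sin (\<epsilon>/2))\<close>.
\<close>

lemma extremal_tree:
  assumes \<epsilon>: "0 < \<epsilon>" "\<epsilon> < pi / 3"
  obtains T where "T \<in> sector_trees \<epsilon> 3" "shortest_tree 3 T \<in> \<A> 0 3"
    "rel_error 3 T = ereal (1 / cos (\<epsilon> / 2) - 1)"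
proof -
  define c \<sigma> where "c = cos (\<epsilon> / 2)" and "\<sigma> = sin (\<epsilon> / 2)"
  let ?\<alpha> = "2 * pi / 3"
  define p :: "nat \<Rightarrow> real^2" where "p = (\<lambda>_. 0)(1 := dir (?\<alpha> + \<epsilon> / 2), 2 := dir (\<epsilon> / 2 - ?\<alpha>), 3 := 2 *\<^sub>R dir (- (\<epsilon> / 2)))"
  have p: "p 0 = 0" "p 1 = 1 *\<^sub>R dir (?\<alpha> + \<epsilon> / 2)" "p 2 = 1 *\<^sub>R dir (\<epsilon> / 2 - ?\<alpha>)"
    "p 3 = 2 *\<^sub>R dir (- (\<epsilon> / 2))"
    by (simp_all add: p_def)
  define q :: "real^2" where "q = vector [0, - 2 * \<sigma>]"
  have c: "0 < c" unfolding c_def using \<epsilon> by (intro cos_gt_zero_pi) auto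
  \<comment> \<open>\<open>c - \<surd>3 \<sigma> = 2 cos (\<epsilon>/2 + \<pi>/3)\<close> is the length of the second edge of the shortest tree;
    for \<open>\<epsilon> \<ge> \<pi>/3\<close> that edge would degenerate.\<close>
  have "0 < cos (\<epsilon> / 2 + pi / 3)" using \<epsilon> by (intro cos_gt_zero_pi) auto
  then have b2: "0 < c - sqrt 3 * \<sigma>" by (simp add: cos_add cos_60 sin_60 c_def \<sigma>_def algebra_simps)
  have "0 \<le> \<sigma>" unfolding \<sigma>_def using \<epsilon> by (intro sin_ge_zero) auto
  then have b1: "0 < c + sqrt 3 * \<sigma>" using c by (intro add_pos_nonneg) auto
  have trig: "cos ?\<alpha> = - 1 / 2" "sin ?\<alpha> = sqrt 3 / 2" by (rule cos_120 sin_120)+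
  have pq: "p 1 - q = (c + sqrt 3 * \<sigma>) *\<^sub>R dir ?\<alpha>" "p 2 - q = (c - sqrt 3 * \<sigma>) *\<^sub>R dir (- ?\<alpha>)"
    "p 3 - q = (2 * c) *\<^sub>R dir 0"
    unfolding p vec_eq_iff forall_2 q_def vector_minus_component vector_scaleR_component dir_nth vector_2
      cos_add sin_add cos_diff sin_diff cos_minus sin_minus trig
    by (simp_all add: c_def \<sigma>_def algebra_simps)
  have tripod: "dir ?\<alpha> + dir (- ?\<alpha>) + dir 0 = 0"
    using dir_tripod[of 1 0] by (simp add: algebra_simps)
  let ?T = "(star3, p)"
  have star: "distinct [0, 1, 2, 3 :: nat]" "edges star3 = (\<lambda>t. {0, t}) ` {1, 2, 3}"
    by (simp_all add: star3_def)
  note len = len_star3[OF star(2,1)]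
  obtain y where S: "shortest_tree 3 ?T = (star3, y)" and y: "y 1 = p 1" "y 2 = p 2" "y 3 = p 3"
    and y_min: "dist (y 0) (p 1) + dist (y 0) (p 2) + dist (y 0) (p 3) \<le> dist q (p 1) + dist q (p 2) + dist q (p 3)"
    using shortest_tree_3[OF star3_full(1) star, of p] by metis
  have y0: "y 0 = q"
    using tripod _ _ _ pq _ _ _ y_min by (rule tripod_unique) (use b1 b2 c in auto)
  have pp: "p 1 - p 0 = 1 *\<^sub>R dir (?\<alpha> + \<epsilon> / 2)" "p 2 - p 0 = 1 *\<^sub>R dir (\<epsilon> / 2 - ?\<alpha>)"
    "p 3 - p 0 = 2 *\<^sub>R dir (- (\<epsilon> / 2))"
    using p by simp_all
  have ang_p: "angle (p 1) (p 0) (p 2) = ?\<alpha>" "angle (p 2) (p 0) (p 3) = ?\<alpha> - \<epsilon>" "angle (p 3) (p 0) (p 1) = ?\<alpha> + \<epsilon>"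
    by (rule angle_dir_eq[OF pp(1,2)] angle_dir_eq[OF pp(2,3)] angle_dir_eq[OF pp(3,1)];
        use \<epsilon> in \<open>simp add: field_simps\<close>)+
  have ang_y: "angle (y 1) (y 0) (y 2) = ?\<alpha>" "angle (y 2) (y 0) (y 3) = ?\<alpha>" "angle (y 3) (y 0) (y 1) = ?\<alpha>"
    unfolding y y0
    by (rule angle_dir_eq[OF pq(1,2)] angle_dir_eq[OF pq(2,3)] angle_dir_eq[OF pq(3,1)];
        use b1 b2 c in \<open>simp add: field_simps\<close>)+
  have "p 1 - p 0 \<noteq> 0" "p 2 - p 0 \<noteq> 0" "p 3 - p 0 \<noteq> 0"
    unfolding pp by simp_all
  then have ne: "p 1 \<noteq> p 0" "p 2 \<noteq> p 0" "p 3 \<noteq> p 0" by simp_all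
  have "p 1 - q \<noteq> 0" "p 2 - q \<noteq> 0" "p 3 - q \<noteq> 0"
    unfolding pq using b1 b2 c by simp_all
  then have ney: "y 1 \<noteq> y 0" "y 2 \<noteq> y 0" "y 3 \<noteq> y 0" unfolding y y0 by simp_all
  have "?T \<in> \<A> \<epsilon> 3"
    unfolding approx_full_trees_def using star3_full ne ang_p \<epsilon>
      angle_commute[of "p 2" "p 0" "p 1"] angle_commute[of "p 3" "p 0" "p 2"] angle_commute[of "p 1" "p 0" "p 3"]
    by (simp del: One_nat_def)
  moreover have "angle (p u) (p 0) (p v) + angle (p v) (p 0) (p w) + angle (p w) (p 0) (p u) = 2 * pi"
    if "{1, 2, 3} = {u, v, w}" for u v w
  proof -
    have "card {u, v, w} = 3" by (simp flip: that)
    then have "u \<noteq> v" "v \<noteq> w" "w \<noteq> u" by (auto simp: card_insert_if split: if_splits)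
    moreover have "u \<in> {1, 2, 3}" "v \<in> {1, 2, 3}" "w \<in> {1, 2, 3}" unfolding that by simp_all
    ultimately show ?thesis
      using ang_p angle_commute[of "p 2" "p 0" "p 1"] angle_commute[of "p 3" "p 0" "p 2"] angle_commute[of "p 1" "p 0" "p 3"]
      by (elim insertE emptyE) (simp_all del: One_nat_def)
  qed
  ultimately have "?T \<in> sector_trees \<epsilon> 3"
    unfolding sector_trees_def using star3_full by simp
  moreover have "shortest_tree 3 ?T \<in> \<A> 0 3"
    unfolding approx_full_trees_def S using star3_full ney ang_y
      angle_commute[of "y 2" "y 0" "y 1"] angle_commute[of "y 3" "y 0" "y 2"] angle_commute[of "y 1" "y 0" "y 3"]
    by (simp del: One_nat_def)
  moreover have "rel_error 3 ?T = ereal (1 / cos (\<epsilon> / 2) - 1)"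
  proof -
    have "len ?T = 4" unfolding len p by simp
    moreover have "dist q (p 1) = c + sqrt 3 * \<sigma>" "dist q (p 2) = c - sqrt 3 * \<sigma>" "dist q (p 3) = 2 * c"
      unfolding dist_norm norm_minus_commute[of q] pq using b1 b2 c by simp_all
    then have "len (shortest_tree 3 ?T) = 4 * c" unfolding S len y y0 by simp
    ultimately show ?thesis using c by (simp add: rel_error_def c_def field_simps)
  qed
  ultimately show ?thesis by (rule that)
qed


section \<open>The suprema\<close>

theorem proposition7p3:
  fixes \<epsilon> :: real
  assumes "0 < \<epsilon>" and "\<epsilon> < pi / 3"
  shows "(\<epsilon> < 2 * pi / 9 \<longrightarrow>
            F TYPE(2) \<epsilon> 3 = G TYPE(2) \<epsilon> 3 \<and>
            G TYPE(2) \<epsilon> 3 = ereal (1 / cos (\<epsilon> / 2) - 1)) \<and>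
         F_sector \<epsilon> 3 = G_sector \<epsilon> 3 \<and>
         G_sector \<epsilon> 3 = ereal (1 / cos (\<epsilon> / 2) - 1)"
proof -
  let ?M = "ereal (1 / cos (\<epsilon> / 2) - 1)"
  obtain T where T: "T \<in> sector_trees \<epsilon> 3" "shortest_tree 3 T \<in> \<A> 0 3" "rel_error 3 T = ?M"
    using assms by (rule extremal_tree)
  have sup: "(SUP T \<in> X. rel_error 3 T) = ?M" if "T \<in> X" "X \<subseteq> sector_trees \<epsilon> 3" for X
  proof (rule antisym)
    show "(SUP T \<in> X. rel_error 3 T) \<le> ?M"
      using that rel_error_sector_le[OF assms] by (intro SUP_least) auto
    show "?M \<le> (SUP T \<in> X. rel_error 3 T)"
      using that(1) T(3) by (metis SUP_upper)
  qed
  have sector: "F_sector \<epsilon> 3 = ?M" "G_sector \<epsilon> 3 = ?M"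
    unfolding F_sector_def G_sector_def by (rule sup; use T in auto)+
  moreover have "F TYPE(2) \<epsilon> 3 = ?M" "G TYPE(2) \<epsilon> 3 = ?M" if "\<epsilon> < 2 * pi / 9"
    using sector sector_trees_eq[OF assms(1) that]
    by (simp_all add: F_def G_def F_sector_def G_sector_def)
  ultimately show ?thesis by simp
qed

end
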